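(* Let $\delta\ge2$ be an integer, $\alpha>0$, and let $\mathbf{g}(u)=\left[g^{\ell}(u)\right]_{\ell=1}^{\delta}$, $u\in[0,\alpha]$, be the smooth parametric curve in $\mathbb{R}^{\delta}$ with coordinate functions $$g^{\ell}(u)=\sum_{p\in P_{\ell}}c_{p}^{\ell}\cosh\left(pu+\psi_{p}^{\ell}\right)+\sum_{q\in Q_{\ell}}s_{q}^{\ell}\sinh\left(qu+\varphi_{q}^{\ell}\right),$$ where $P_{\ell},Q_{\ell}\subset\mathbb{N}$ are finite and $c_{p}^{\ell},\psi_{p}^{\ell},s_{q}^{\ell},\varphi_{q}^{\ell}\in\mathbb{R}$. Then for any arbitrarily fixed integer order $n\ge1$ with $n\ge n_{\min}=\max\left\{z:z\in\bigcup_{\ell=1}^{\delta}(P_{\ell}\cup Q_{\ell})\right\}$, the curve $\mathbf{g}$ has a unique control point based exact description, i.e. there are unique control points $\mathbf{d}_{0},\ldots,\mathbf{d}_{2n}\in\mathbb{R}^{\delta}$ with $\mathbf{g}(u)=\sum_{i=0}^{2n}\mathbf{d}_{i}H_{2n,i}^{\alpha}(u)$ for all $u\in[0,\alpha]$. More precisely, for every $r\in\mathbb{N}$, $\ell=1,\ldots,\delta$ and $u\in[0,\alpha]$, $$\frac{\mathrm{d}^{r}}{\mathrm{d}u^{r}}g^{\ell}(u)=\sum_{i=0}^{2n}d_{i}^{\ell}(r)\,H_{2n,i}^{\alpha}(u),$$ where, if $r$ is even, $$d_{i}^{\ell}(r)=\sum_{p\in P_{\ell}}c_{p}^{\ell}p^{r}\left(\rho_{p,i}^{n}\cosh(\psi_{p}^{\ell})+\sigma_{p,i}^{n}\sinh(\psi_{p}^{\ell})\right)+\sum_{q\in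 Q_{\ell}}s_{q}^{\ell}q^{r}\left(\sigma_{q,i}^{n}\cosh(\varphi_{q}^{\ell})+\rho_{q,i}^{n}\sinh(\varphi_{q}^{\ell})\right),$$ and, if $r$ is odd, $$d_{i}^{\ell}(r)=\sum_{p\in P_{\ell}}c_{p}^{\ell}p^{r}\left(\sigma_{p,i}^{n}\cosh(\psi_{p}^{\ell})+\rho_{p,i}^{n}\sinh(\psi_{p}^{\ell})\right)+\sum_{q\in Q_{\ell}}s_{q}^{\ell}q^{r}\left(\rho_{q,i}^{n}\cosh(\varphi_{q}^{\ell})+\sigma_{q,i}^{n}\sinh(\varphi_{q}^{\ell})\right);$$ here $d_{i}^{\ell}(r)$ is the $\ell$th coordinate of the $i$th control point of the hyperbolic curve description (of the $r$th derivative of $\mathbf{g}$).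
   Context: Here $\mathbb{N}=\{0,1,2,\ldots\}$ and $0^{0}=1$. For an integer $n\ge1$ and $\alpha>0$ let $$H_{2n,i}^{\alpha}(u)=h_{2n,i}^{\alpha}\,\sinh^{2n-i}\!\left(\tfrac{\alpha-u}{2}\right)\sinh^{i}\!\left(\tfrac{u}{2}\right),\quad u\in[0,\alpha],\ i=0,1,\ldots,2n,$$ where $$h_{2n,i}^{\alpha}=\frac{1}{\sinh^{2n}(\alpha/2)}\sum_{r=0}^{\lfloor i/2\rfloor}\binom{n}{i-r}\binom{i-r}{r}\left(2\cosh(\alpha/2)\right)^{i-2r}.$$ The functions $\{H_{2n,i}^{\alpha}\}_{i=0}^{2n}$ form a basis (the normalized B-basis) of $\operatorname{span}\{\cosh(ku),\sinh(ku):u\in[0,\alpha]\}_{k=0}^{n}$. For $k\in\{0,1,\ldots,n\}$, $\{\sigma_{k,i}^{n}\}_{i=0}^{2n}$ and $\{\rho_{k,i}^{n}\}_{i=0}^{2n}$ denote the unique real numbers such that, for all $u\in[0,\alpha]$, $$\sinh(ku)=\sum_{i=0}^{2n}\sigma_{k,i}^{n}H_{2n,i}^{\alpha}(u),\qquad \cosh(ku)=\sum_{i=0}^{2n}\rho_{k,i}^{n}H_{2n,i}^{\alpha}(u).$$ *)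

theory Defs
  imports "HOL-Analysis.Analysis"
begin

definition hyp_norm :: "nat \<Rightarrow> real \<Rightarrow> nat \<Rightarrow> real" where
  "hyp_norm n \<alpha> i =
     1 / sinh (\<alpha> / 2) ^ (2 * n) *
     (\<Sum>r = 0..i div 2. real (n choose (i - r)) * real ((i - r) choose r)
                        * (2 * cosh (\<alpha> / 2)) ^ (i - 2 * r))"

definition hyp_basis :: "nat \<Rightarrow> real \<Rightarrow> nat \<Rightarrow> real \<Rightarrow> real" where
  "hyp_basis n \<alpha> i u =
     hyp_norm n \<alpha> i * sinh ((\<alpha> - u) / 2) ^ (2 * n - i) * sinh (u / 2) ^ i"

text \<open>
  Tuples indexed by \<open>0, \<dots>, 2n\<close> are functions on \<^typ>\<open>nat\<close> that are extensional on
  \<open>{..2 * n}\<close>; this makes the uniqueness implicit in the two descriptions below (which are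
  meaningful for \<open>\<alpha> > 0\<close> and \<open>k \<le> n\<close>) a statement about the entries
  \<open>0, \<dots>, 2n\<close> only.
\<close>

definition sinh_coeff :: "nat \<Rightarrow> real \<Rightarrow> nat \<Rightarrow> nat \<Rightarrow> real" where
  "sinh_coeff n \<alpha> k =
     (THE \<sigma>. \<sigma> \<in> {..2 * n} \<rightarrow>\<^sub>E UNIV \<and>
        (\<forall>u\<in>{0..\<alpha>}. sinh (real k * u) = (\<Sum>i\<le>2 * n. \<sigma> i * hyp_basis n \<alpha> i u)))"

definition cosh_coeff :: "nat \<Rightarrow> real \<Rightarrow> nat \<Rightarrow> nat \<Rightarrow> real" where
  "cosh_coeff n \<alpha> k =
     (THE \<rho>. \<rho> \<in> {..2 * n} \<rightarrow>\<^sub>E UNIV \<and>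
        (\<forall>u\<in>{0..\<alpha>}. cosh (real k * u) = (\<Sum>i\<le>2 * n. \<rho> i * hyp_basis n \<alpha> i u)))"

definition hyp_fun ::
  "nat set \<Rightarrow> nat set \<Rightarrow> (nat \<Rightarrow> real) \<Rightarrow> (nat \<Rightarrow> real) \<Rightarrow> (nat \<Rightarrow> real) \<Rightarrow> (nat \<Rightarrow> real) \<Rightarrow> real \<Rightarrow> real"
where
  "hyp_fun P Q c \<psi> s \<phi> u =
     (\<Sum>p\<in>P. c p * cosh (real p * u + \<psi> p)) + (\<Sum>q\<in>Q. s q * sinh (real q * u + \<phi> q))"

text \<open>The inserted \<open>0\<close> only matters when all the index sets are empty.\<close>

definition min_order :: "('d \<Rightarrow> nat set) \<Rightarrow> ('d \<Rightarrow> nat set) \<Rightarrow> nat" where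
  "min_order P Q = Max (insert 0 (\<Union>l. P l \<union> Q l))"

text \<open>The \<open>r\<close>-th derivative relative to \<open>S\<close>, hence one-sided at the endpoints of an interval.\<close>

definition nth_deriv_on :: "real set \<Rightarrow> nat \<Rightarrow> (real \<Rightarrow> real) \<Rightarrow> real \<Rightarrow> real" where
  "nth_deriv_on S r f = ((\<lambda>h u. vector_derivative h (at u within S)) ^^ r) f"

definition ctrl_coord ::
  "nat \<Rightarrow> real \<Rightarrow> nat set \<Rightarrow> nat set \<Rightarrow> (nat \<Rightarrow> real) \<Rightarrow> (nat \<Rightarrow> real) \<Rightarrow> (nat \<Rightarrow> real) \<Rightarrow> (nat \<Rightarrow> real)
    \<Rightarrow> nat \<Rightarrow> nat \<Rightarrow> real"
where
  "ctrl_coord n \<alpha> P Q c \<psi> s \<phi> r i =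
     (if even r then
        (\<Sum>p\<in>P. c p * real p ^ r *
           (cosh_coeff n \<alpha> p i * cosh (\<psi> p) + sinh_coeff n \<alpha> p i * sinh (\<psi> p))) +
        (\<Sum>q\<in>Q. s q * real q ^ r *
           (sinh_coeff n \<alpha> q i * cosh (\<phi> q) + cosh_coeff n \<alpha> q i * sinh (\<phi> q)))
      else
        (\<Sum>p\<in>P. c p * real p ^ r *
           (sinh_coeff n \<alpha> p i * cosh (\<psi> p) + cosh_coeff n \<alpha> p i * sinh (\<psi> p))) +
        (\<Sum>q\<in>Q. s q * real q ^ r *
           (cosh_coeff n \<alpha> q i * cosh (\<phi> q) + sinh_coeff n \<alpha> q i * sinh (\<phi> q))))"

end

theory Submission
  imports Defs
begin

text \<open>
  Put \<open>A u = sinh ((\<alpha> - u) / 2)\<close> and \<open>B u = sinh (u / 2)\<close>. Up to nonzero factors the basis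
  functions are the monomials \<open>A\<^sup>2\<^sup>n\<^sup>-\<^sup>i B\<^sup>i\<close>, so their span consists of the values of the binary
  forms of degree \<open>2n\<close> at \<open>(A u, B u)\<close>. Existence and uniqueness of coefficients are questions about
  such forms.

  Both \<open>exp (u / 2)\<close> and \<open>exp (- u / 2)\<close> are linear forms in \<open>A u\<close> and \<open>B u\<close>; hence for
  \<open>k \<le> n\<close> the function \<open>exp (\<plusminus> k u)\<close>, the product of the \<open>(n + k)\<close>-th power
  of one and the \<open>(n - k)\<close>-th power of the other, is a form of degree \<open>2n\<close> (\<open>exp_in_span\<close>), and so are \<open>cosh (k u)\<close> and \<open>sinh (k u)\<close>. On \<open>[0, \<alpha>)\<close> the quotient
  \<open>B / A\<close> is defined and strictly increasing, so a form of degree \<open>2n\<close> that vanishes there gives,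
  after division by \<open>A\<^sup>2\<^sup>n\<close>, a polynomial with infinitely many zeros; hence its coefficients are
  zero (\<open>hyp_basis_coeffs_unique\<close>).

  The addition theorems then express each coordinate function in the basis (\<open>hyp_fun_expansion\<close>).
  Differentiation multiplies amplitudes by frequencies and exchanges the roles of \<open>cosh\<close>
  and \<open>sinh\<close>, so every derivative is again a function of the same kind with
  frequencies at most \<open>n\<close>, to which the same expansion applies.
\<close>

section \<open>The basis: positivity of the constants and uniqueness of coefficients\<close>

lemma hyp_norm_pos:
  assumes "\<alpha> > 0" "i \<le> 2 * n"
  shows "hyp_norm n \<alpha> i > 0"
proof -
  let ?t = "\<lambda>r. real (n choose (i - r)) * real ((i - r) choose r)
                  * (2 * cosh (\<alpha> / 2)) ^ (i - 2 * r)"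
  have cosh: "cosh (\<alpha> / 2) > 0"
    by simp
  \<comment> \<open>The last summand is always positive, whereas those with \<open>i - r > n\<close> vanish.\<close>
  have "i - i div 2 \<le> n" "i div 2 \<le> i - i div 2"
    using assms(2) by linarith+
  hence "?t (i div 2) > 0"
    using cosh by (intro mult_pos_pos zero_less_power) (simp_all add: zero_less_binomial_iff)
  hence "(\<Sum>r = 0..i div 2. ?t r) > 0"
    using cosh by (intro sum_pos2[of _ "i div 2"]) (auto intro!: mult_nonneg_nonneg)
  thus ?thesis
    using assms(1) by (simp add: hyp_norm_def)
qed

lemma sinh_quotient_strict_mono:
  fixes \<alpha> :: real
  assumes "0 \<le> u" "u < v" "v < \<alpha>"
  shows "sinh (u / 2) / sinh ((\<alpha> - u) / 2) < sinh (v / 2) / sinh ((\<alpha> - v) / 2)"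
  using assms by (intro frac_less) auto

lemma hyp_basis_coeffs_zero:
  assumes \<alpha>: "\<alpha> > 0"
    and zero: "\<And>u. u \<in> {0..\<alpha>} \<Longrightarrow> (\<Sum>i\<le>2 * n. a i * hyp_basis n \<alpha> i u) = 0"
    and i: "i \<le> 2 * n"
  shows "a i = 0"
proof -
  define t where "t = (\<lambda>u. sinh (u / 2) / sinh ((\<alpha> - u) / 2))"
  have "inj_on t {0..<\<alpha>}"
    unfolding t_def by (rule linorder_inj_onI) (use sinh_quotient_strict_mono in force)+
  hence inf: "infinite (t ` {0..<\<alpha>})"
    using \<alpha> by (simp add: finite_image_iff)
  have "(\<Sum>i\<le>2 * n. a i * hyp_norm n \<alpha> i * t u ^ i) = 0" if u: "u \<in> {0..<\<alpha>}" for u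
  proof -
    define A where "A = sinh ((\<alpha> - u) / 2)"
    have A: "A > 0"
      using u by (simp add: A_def)
    have "A ^ (2 * n) * (\<Sum>i\<le>2 * n. a i * hyp_norm n \<alpha> i * t u ^ i)
        = (\<Sum>i\<le>2 * n. a i * hyp_basis n \<alpha> i u)"
      unfolding sum_distrib_left
    proof (rule sum.cong)
      fix i assume "i \<in> {..2 * n}"
      hence "A ^ (2 * n) = A ^ (2 * n - i) * A ^ i"
        by (simp flip: power_add)
      thus "A ^ (2 * n) * (a i * hyp_norm n \<alpha> i * t u ^ i) = a i * hyp_basis n \<alpha> i u"
        using A by (simp add: hyp_basis_def t_def power_divide flip: A_def)
    qed simp
    also have "\<dots> = 0"
      using u by (intro zero) auto
    finally show ?thesis
      using A by simp
  qed
  hence "t ` {0..<\<alpha>} \<subseteq> {x. (\<Sum>i\<le>2 * n. a i * hyp_norm n \<alpha> i * x ^ i) = 0}"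
    by auto
  hence "infinite {x. (\<Sum>i\<le>2 * n. a i * hyp_norm n \<alpha> i * x ^ i) = 0}"
    using inf finite_subset by blast
  hence "a i * hyp_norm n \<alpha> i = 0"
    using i unfolding polyfun_finite_roots by blast
  thus ?thesis
    using hyp_norm_pos[OF \<alpha> i] by simp
qed

lemma hyp_basis_coeffs_unique:
  assumes "\<alpha> > 0"
    and "\<And>u. u \<in> {0..\<alpha>} \<Longrightarrow>
           (\<Sum>i\<le>2 * n. a i * hyp_basis n \<alpha> i u) = (\<Sum>i\<le>2 * n. b i * hyp_basis n \<alpha> i u)"
    and "i \<le> 2 * n"
  shows "a i = b i"
  using hyp_basis_coeffs_zero[where a = "\<lambda>i. a i - b i", OF assms(1) _ assms(3)] assms(2)
  by (simp add: left_diff_distrib sum_subtractf)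

section \<open>The exponentials lie in the span\<close>

lemma binary_form_mult_linear:
  fixes w :: "nat \<Rightarrow> real"
  obtains w' where
    "\<And>a b. (a + x * b) * (\<Sum>i\<le>N. w i * a ^ (N - i) * b ^ i)
         = (\<Sum>i\<le>Suc N. w' i * a ^ (Suc N - i) * b ^ i)"
proof
  fix a b :: real
  let ?v = "\<lambda>i. if i \<le> N then w i else 0"
  let ?v' = "\<lambda>i. case i of 0 \<Rightarrow> 0 | Suc j \<Rightarrow> x * w j"
  have 1: "a * (\<Sum>i\<le>N. w i * a ^ (N - i) * b ^ i)
      = (\<Sum>i\<le>Suc N. ?v i * a ^ (Suc N - i) * b ^ i)"
    by (simp add: sum_distrib_left Suc_diff_le mult_ac)
  have 2: "x * b * (\<Sum>i\<le>N. w i * a ^ (N - i) * b ^ i)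
      = (\<Sum>i\<le>Suc N. ?v' i * a ^ (Suc N - i) * b ^ i)"
    unfolding sum.atMost_Suc_shift by (simp add: sum_distrib_left mult_ac)
  show "(a + x * b) * (\<Sum>i\<le>N. w i * a ^ (N - i) * b ^ i)
      = (\<Sum>i\<le>Suc N. (?v i + ?v' i) * a ^ (Suc N - i) * b ^ i)"
    by (simp only: distrib_right 1 2 sum.distrib)
qed

lemma binary_form_power_mult_power:
  fixes x y :: real
  shows "\<exists>w. \<forall>a b. (a + x * b) ^ j * (a + y * b) ^ m
           = (\<Sum>i\<le>j + m. w i * a ^ (j + m - i) * b ^ i)"
proof (induction j)
  case 0
  show ?case
  proof (induction m)
    case 0
    show ?case by (intro exI[of _ "\<lambda>_. 1"]) simp
  next
    case (Suc m)
    then obtain w where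
      w: "\<And>a b. (a + x * b) ^ 0 * (a + y * b) ^ m = (\<Sum>i\<le>0 + m. w i * a ^ (0 + m - i) * b ^ i)"
      by blast
    obtain w' where
      w': "\<And>a b. (a + y * b) * (\<Sum>i\<le>0 + m. w i * a ^ (0 + m - i) * b ^ i)
         = (\<Sum>i\<le>Suc (0 + m). w' i * a ^ (Suc (0 + m) - i) * b ^ i)"
      using binary_form_mult_linear by blast
    show ?case
      using w'[folded w] by (intro exI[of _ w']) simp
  qed
next
  case (Suc j)
  then obtain w where
    w: "\<And>a b. (a + x * b) ^ j * (a + y * b) ^ m = (\<Sum>i\<le>j + m. w i * a ^ (j + m - i) * b ^ i)"
    by blast
  obtain w' where
    w': "\<And>a b. (a + x * b) * (\<Sum>i\<le>j + m. w i * a ^ (j + m - i) * b ^ i)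
       = (\<Sum>i\<le>Suc (j + m). w' i * a ^ (Suc (j + m) - i) * b ^ i)"
    using binary_form_mult_linear by blast
  show ?case
    using w'[folded w] by (intro exI[of _ w']) (simp add: mult.assoc)
qed

lemma exp_half_linear_form:
  fixes \<alpha> u :: real
  shows "exp (u / 2) * sinh (\<alpha> / 2) = sinh ((\<alpha> - u) / 2) + exp (\<alpha> / 2) * sinh (u / 2)"
    and "exp (- (u / 2)) * sinh (\<alpha> / 2) = sinh ((\<alpha> - u) / 2) + exp (- (\<alpha> / 2)) * sinh (u / 2)"
proof -
  have sinh_diff_half: "sinh ((\<alpha> - u) / 2) = sinh (\<alpha> / 2) * cosh (u / 2) - cosh (\<alpha> / 2) * sinh (u / 2)"
    by (simp add: diff_divide_distrib sinh_diff)
  have exps: "exp (u / 2) = cosh (u / 2) + sinh (u / 2)"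
    "exp (- (u / 2)) = cosh (u / 2) - sinh (u / 2)"
    "exp (\<alpha> / 2) = cosh (\<alpha> / 2) + sinh (\<alpha> / 2)"
    "exp (- (\<alpha> / 2)) = cosh (\<alpha> / 2) - sinh (\<alpha> / 2)"
    by (simp_all add: cosh_plus_sinh cosh_minus_sinh)
  show "exp (u / 2) * sinh (\<alpha> / 2) = sinh ((\<alpha> - u) / 2) + exp (\<alpha> / 2) * sinh (u / 2)"
    "exp (- (u / 2)) * sinh (\<alpha> / 2) = sinh ((\<alpha> - u) / 2) + exp (- (\<alpha> / 2)) * sinh (u / 2)"
    by (simp_all only: sinh_diff_half exps) (simp_all add: algebra_simps)
qed

text \<open>For \<open>k \<le> n\<close>, the choices \<open>j = n \<plusminus> k\<close> and \<open>m = n \<mp> k\<close> give \<open>exp (\<plusminus> k u)\<close>.\<close>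

lemma exp_in_span:
  assumes \<alpha>: "\<alpha> > 0" and jm: "j + m = 2 * n"
  shows "\<exists>w. \<forall>u. exp ((real j - real m) * (u / 2)) = (\<Sum>i\<le>2 * n. w i * hyp_basis n \<alpha> i u)"
proof -
  let ?S = "sinh (\<alpha> / 2)"
  obtain w where w: "\<And>a b. (a + exp (\<alpha> / 2) * b) ^ j * (a + exp (- (\<alpha> / 2)) * b) ^ m
      = (\<Sum>i\<le>j + m. w i * a ^ (j + m - i) * b ^ i)"
    using binary_form_power_mult_power[of "exp (\<alpha> / 2)" j "exp (- (\<alpha> / 2))" m] by blast
  have S: "?S > 0"
    using \<alpha> by simp
  have "exp ((real j - real m) * (u / 2))
      = (\<Sum>i\<le>2 * n. w i / (?S ^ (2 * n) * hyp_norm n \<alpha> i) * hyp_basis n \<alpha> i u)" for u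
  proof -
    have "exp ((real j - real m) * (u / 2)) = exp (real j * (u / 2)) * exp (real m * (- (u / 2)))"
      by (simp add: left_diff_distrib flip: exp_add)
    also have "\<dots> = exp (u / 2) ^ j * exp (- (u / 2)) ^ m"
      by (simp only: exp_of_nat_mult)
    finally have "?S ^ (2 * n) * exp ((real j - real m) * (u / 2))
        = (exp (u / 2) * ?S) ^ j * (exp (- (u / 2)) * ?S) ^ m"
      by (simp add: power_mult_distrib power_add flip: jm)
    also have "\<dots> = (\<Sum>i\<le>2 * n. w i * sinh ((\<alpha> - u) / 2) ^ (2 * n - i) * sinh (u / 2) ^ i)"
      by (simp only: exp_half_linear_form[of u \<alpha>] w jm)
    also have "\<dots> = ?S ^ (2 * n) *
        (\<Sum>i\<le>2 * n. w i / (?S ^ (2 * n) * hyp_norm n \<alpha> i) * hyp_basis n \<alpha> i u)"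
      unfolding sum_distrib_left
    proof (rule sum.cong)
      fix i assume "i \<in> {..2 * n}"
      thus "w i * sinh ((\<alpha> - u) / 2) ^ (2 * n - i) * sinh (u / 2) ^ i
          = ?S ^ (2 * n) * (w i / (?S ^ (2 * n) * hyp_norm n \<alpha> i) * hyp_basis n \<alpha> i u)"
        using S hyp_norm_pos[OF \<alpha>, of i n] by (simp add: hyp_basis_def)
    qed simp
    finally show ?thesis
      using S by simp
  qed
  thus ?thesis
    by (intro exI allI)
qed

lemma hyperbolic_in_span:
  assumes "\<alpha> > 0" "k \<le> n"
  shows "\<exists>w. \<forall>u. sinh (real k * u) = (\<Sum>i\<le>2 * n. w i * hyp_basis n \<alpha> i u)"
    and "\<exists>w. \<forall>u. cosh (real k * u) = (\<Sum>i\<le>2 * n. w i * hyp_basis n \<alpha> i u)"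
proof -
  obtain v where v: "\<And>u. exp (real k * u) = (\<Sum>i\<le>2 * n. v i * hyp_basis n \<alpha> i u)"
    using exp_in_span[of \<alpha> "n + k" "n - k" n] assms by (auto simp: of_nat_diff)
  obtain w where w: "\<And>u. exp (- (real k * u)) = (\<Sum>i\<le>2 * n. w i * hyp_basis n \<alpha> i u)"
    using exp_in_span[of \<alpha> "n - k" "n + k" n] assms by (auto simp: of_nat_diff)
  show "\<exists>w. \<forall>u. sinh (real k * u) = (\<Sum>i\<le>2 * n. w i * hyp_basis n \<alpha> i u)"
    by (intro exI[of _ "\<lambda>i. (v i - w i) / 2"])
      (simp add: sinh_field_def v w left_diff_distrib sum_subtractf flip: sum_divide_distrib)
  show "\<exists>w. \<forall>u. cosh (real k * u) = (\<Sum>i\<le>2 * n. w i * hyp_basis n \<alpha> i u)"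
    by (intro exI[of _ "\<lambda>i. (v i + w i) / 2"])
      (simp add: cosh_field_def v w distrib_right sum.distrib flip: sum_divide_distrib)
qed

section \<open>Expansion of the coordinate functions\<close>

lemma ex1_extensional_coeffs:
  assumes "\<alpha> > 0" and "\<exists>w. \<forall>u. f u = (\<Sum>i\<le>2 * n. w i * hyp_basis n \<alpha> i u)"
  shows "\<exists>!w. w \<in> {..2 * n} \<rightarrow>\<^sub>E UNIV \<and>
           (\<forall>u\<in>{0..\<alpha>}. f u = (\<Sum>i\<le>2 * n. w i * hyp_basis n \<alpha> i u))"
proof -
  obtain w where w: "\<And>u. f u = (\<Sum>i\<le>2 * n. w i * hyp_basis n \<alpha> i u)"
    using assms(2) by blast
  show ?thesis
  proof (rule ex1I[of _ "restrict w {..2 * n}"])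
    fix v
    assume v: "v \<in> {..2 * n} \<rightarrow>\<^sub>E UNIV \<and>
             (\<forall>u\<in>{0..\<alpha>}. f u = (\<Sum>i\<le>2 * n. v i * hyp_basis n \<alpha> i u))"
    have "v i = w i" if "i \<le> 2 * n" for i
      using hyp_basis_coeffs_unique[OF assms(1) _ that, of v w] v w by metis
    thus "v = restrict w {..2 * n}"
      using v by (intro PiE_ext[of v "{..2 * n}" "\<lambda>_. UNIV"]) auto
  qed (simp add: w)
qed

lemma sinh_coeff_expansion:
  assumes "\<alpha> > 0" "k \<le> n" "u \<in> {0..\<alpha>}"
  shows "sinh (real k * u) = (\<Sum>i\<le>2 * n. sinh_coeff n \<alpha> k i * hyp_basis n \<alpha> i u)"
  using theI'[OF ex1_extensional_coeffs[OF assms(1) hyperbolic_in_span(1)[OF assms(1,2)]]] assms(3)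
  unfolding sinh_coeff_def by blast

lemma cosh_coeff_expansion:
  assumes "\<alpha> > 0" "k \<le> n" "u \<in> {0..\<alpha>}"
  shows "cosh (real k * u) = (\<Sum>i\<le>2 * n. cosh_coeff n \<alpha> k i * hyp_basis n \<alpha> i u)"
  using theI'[OF ex1_extensional_coeffs[OF assms(1) hyperbolic_in_span(2)[OF assms(1,2)]]] assms(3)
  unfolding cosh_coeff_def by blast

lemma hyp_fun_expansion:
  assumes "\<alpha> > 0" "\<And>k. k \<in> P \<union> Q \<Longrightarrow> k \<le> n" "u \<in> {0..\<alpha>}"
  shows "hyp_fun P Q c \<psi> s \<phi> u
       = (\<Sum>i\<le>2 * n. ctrl_coord n \<alpha> P Q c \<psi> s \<phi> 0 i * hyp_basis n \<alpha> i u)"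
proof -
  have lin: "x * ((\<Sum>i\<le>2 * n. a i * b i) * y + (\<Sum>i\<le>2 * n. a' i * b i) * z)
      = (\<Sum>i\<le>2 * n. x * (a i * y + a' i * z) * b i)" for x y z :: real and a a' b
    by (simp add: sum_distrib_left sum_distrib_right sum.distrib distrib_left distrib_right mult_ac)
  have "c p * cosh (real p * u + \<psi> p) = (\<Sum>i\<le>2 * n. c p *
      (cosh_coeff n \<alpha> p i * cosh (\<psi> p) + sinh_coeff n \<alpha> p i * sinh (\<psi> p)) * hyp_basis n \<alpha> i u)"
    if "p \<in> P" for p
    using that assms
    by (simp only: cosh_add cosh_coeff_expansion[of \<alpha> p n u] sinh_coeff_expansion[of \<alpha> p n u]
        lin UnI1)
  moreover have "s q * sinh (real q * u + \<phi> q) = (\<Sum>i\<le>2 * n. s q *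
      (sinh_coeff n \<alpha> q i * cosh (\<phi> q) + cosh_coeff n \<alpha> q i * sinh (\<phi> q)) * hyp_basis n \<alpha> i u)"
    if "q \<in> Q" for q
    using that assms
    by (simp only: sinh_add cosh_coeff_expansion[of \<alpha> q n u] sinh_coeff_expansion[of \<alpha> q n u]
        lin UnI2)
  ultimately show ?thesis
    by (simp add: hyp_fun_def ctrl_coord_def distrib_right sum_distrib_right sum.distrib
        sum.swap[of _ "{..2 * n}"])
qed

section \<open>Derivatives\<close>

text \<open>
  The closed form of the \<open>r\<close>-th derivative of \<^const>\<open>hyp_fun\<close>: amplitudes are multiplied by
  the \<open>r\<close>-th powers of the frequencies, and for odd \<open>r\<close> the \<open>cosh\<close> and \<open>sinh\<close> parts trade
  places.
\<close>

definition hyp_fun_deriv ::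
  "nat set \<Rightarrow> nat set \<Rightarrow> (nat \<Rightarrow> real) \<Rightarrow> (nat \<Rightarrow> real) \<Rightarrow> (nat \<Rightarrow> real) \<Rightarrow> (nat \<Rightarrow> real)
    \<Rightarrow> nat \<Rightarrow> real \<Rightarrow> real"
where
  "hyp_fun_deriv P Q c \<psi> s \<phi> r =
     (if even r then hyp_fun P Q (\<lambda>p. c p * real p ^ r) \<psi> (\<lambda>q. s q * real q ^ r) \<phi>
      else hyp_fun Q P (\<lambda>q. s q * real q ^ r) \<phi> (\<lambda>p. c p * real p ^ r) \<psi>)"

lemma hyp_fun_deriv_0 [simp]: "hyp_fun_deriv P Q c \<psi> s \<phi> 0 = hyp_fun P Q c \<psi> s \<phi>"
  by (simp add: hyp_fun_deriv_def)

lemma ctrl_coord_even_odd: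
  "ctrl_coord n \<alpha> P Q c \<psi> s \<phi> r i =
     (if even r then ctrl_coord n \<alpha> P Q (\<lambda>p. c p * real p ^ r) \<psi> (\<lambda>q. s q * real q ^ r) \<phi> 0 i
      else ctrl_coord n \<alpha> Q P (\<lambda>q. s q * real q ^ r) \<phi> (\<lambda>p. c p * real p ^ r) \<psi> 0 i)"
  by (simp add: ctrl_coord_def add_ac)

lemma hyp_fun_deriv_expansion:
  assumes "\<alpha> > 0" "\<And>k. k \<in> P \<union> Q \<Longrightarrow> k \<le> n" "u \<in> {0..\<alpha>}"
  shows "hyp_fun_deriv P Q c \<psi> s \<phi> r u
       = (\<Sum>i\<le>2 * n. ctrl_coord n \<alpha> P Q c \<psi> s \<phi> r i * hyp_basis n \<alpha> i u)"
  unfolding hyp_fun_deriv_def ctrl_coord_even_odd[of n \<alpha> P Q c \<psi> s \<phi> r]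
  using hyp_fun_expansion[of \<alpha> P Q n u] hyp_fun_expansion[of \<alpha> Q P n u] assms
  by (simp add: disj_commute)

lemma hyp_fun_has_vector_derivative:
  "(hyp_fun P Q c \<psi> s \<phi> has_vector_derivative
      hyp_fun Q P (\<lambda>q. s q * real q) \<phi> (\<lambda>p. c p * real p) \<psi> u) (at u within S)"
  unfolding hyp_fun_def has_real_derivative_iff_has_vector_derivative[symmetric]
  by (auto intro!: derivative_eq_intros sum.cong simp: mult_ac add.commute)

lemma hyp_fun_deriv_has_vector_derivative:
  "(hyp_fun_deriv P Q c \<psi> s \<phi> r has_vector_derivative hyp_fun_deriv P Q c \<psi> s \<phi> (Suc r) u)
     (at u within S)"
  using hyp_fun_has_vector_derivative[of P Q "\<lambda>p. c p * real p ^ r" \<psi> "\<lambda>q. s q * real q ^ r" \<phi> u S]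
    hyp_fun_has_vector_derivative[of Q P "\<lambda>q. s q * real q ^ r" \<phi> "\<lambda>p. c p * real p ^ r" \<psi> u S]
  by (simp add: hyp_fun_deriv_def mult_ac)

lemma nth_deriv_on_interval:
  fixes F :: "nat \<Rightarrow> real \<Rightarrow> real"
  assumes "a < b"
    and f: "\<And>u. u \<in> {a..b} \<Longrightarrow> f u = F 0 u"
    and F: "\<And>r u. u \<in> {a..b} \<Longrightarrow> (F r has_vector_derivative F (Suc r) u) (at u within {a..b})"
    and u: "u \<in> {a..b}"
  shows "nth_deriv_on {a..b} r f u = F r u"
    and "(nth_deriv_on {a..b} r f has_vector_derivative F (Suc r) u) (at u within {a..b})"
proof -
  have step: "(nth_deriv_on {a..b} r f has_vector_derivative F (Suc r) u) (at u within {a..b})"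
    if "\<And>v. v \<in> {a..b} \<Longrightarrow> nth_deriv_on {a..b} r f v = F r v" and "u \<in> {a..b}" for r u
    using has_vector_derivative_transform[OF that(2) _ F[OF that(2)]] that(1) by simp
  have eq: "nth_deriv_on {a..b} r f u = F r u" if "u \<in> {a..b}" for r u
    using that
  proof (induction r arbitrary: u)
    case 0
    thus ?case by (simp add: nth_deriv_on_def f)
  next
    case (Suc r)
    have "nth_deriv_on {a..b} (Suc r) f u
        = vector_derivative (nth_deriv_on {a..b} r f) (at u within {a..b})"
      by (simp add: nth_deriv_on_def)
    also have "\<dots> = F (Suc r) u"
      using \<open>a < b\<close> Suc step by (intro vector_derivative_within_closed_interval) auto
    finally show ?case .
  qed
  show "nth_deriv_on {a..b} r f u = F r u"
    using eq u .
  show "(nth_deriv_on {a..b} r f has_vector_derivative F (Suc r) u) (at u within {a..b})"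
    using step[OF eq u] .
qed

section \<open>Control points of the curve\<close>

lemma le_min_order:
  fixes P Q :: "'d::finite \<Rightarrow> nat set"
  assumes "\<And>l. finite (P l)" "\<And>l. finite (Q l)" "k \<in> P l \<union> Q l"
  shows "k \<le> min_order P Q"
  unfolding min_order_def using assms by (intro Max_ge) auto

theorem theorem5p3:
  fixes \<alpha> :: real
    and n :: nat
    and P Q :: "'d::finite \<Rightarrow> nat set"
    and c \<psi> s \<phi> :: "'d \<Rightarrow> nat \<Rightarrow> real"
    and g :: "real \<Rightarrow> real ^ 'd"
  assumes "CARD('d) \<ge> 2"
    and "\<alpha> > 0"
    and "\<And>l. finite (P l)"
    and "\<And>l. finite (Q l)"
    and "\<And>u l. u \<in> {0..\<alpha>} \<Longrightarrow> g u $ l = hyp_fun (P l) (Q l) (c l) (\<psi> l) (s l) (\<phi> l) u"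
    and "n \<ge> 1"
    and "n \<ge> min_order P Q"
  shows "(\<exists>!d. d \<in> {..2 * n} \<rightarrow>\<^sub>E (UNIV :: (real ^ 'd) set) \<and>
            (\<forall>u\<in>{0..\<alpha>}. g u = (\<Sum>i\<le>2 * n. hyp_basis n \<alpha> i u *\<^sub>R d i))) \<and>
         (\<forall>r l. \<forall>u\<in>{0..\<alpha>}.
            nth_deriv_on {0..\<alpha>} r (\<lambda>v. g v $ l) differentiable (at u within {0..\<alpha>}) \<and>
            nth_deriv_on {0..\<alpha>} r (\<lambda>v. g v $ l) u =
              (\<Sum>i\<le>2 * n. ctrl_coord n \<alpha> (P l) (Q l) (c l) (\<psi> l) (s l) (\<phi> l) r i
                            * hyp_basis n \<alpha> i u))"
proof -
  note \<alpha> = \<open>\<alpha> > 0\<close>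
  have le_n: "k \<le> n" if "k \<in> P l \<union> Q l" for k l
    using le_min_order[of P Q, OF assms(3,4) that] assms(7) by linarith
  let ?D = "\<lambda>l. hyp_fun_deriv (P l) (Q l) (c l) (\<psi> l) (s l) (\<phi> l)"
  let ?ctrl = "\<lambda>r l. ctrl_coord n \<alpha> (P l) (Q l) (c l) (\<psi> l) (s l) (\<phi> l) r"
  have expansion: "?D l r u = (\<Sum>i\<le>2 * n. ?ctrl r l i * hyp_basis n \<alpha> i u)"
    if "u \<in> {0..\<alpha>}" for r l u
    using \<alpha> le_n that by (rule hyp_fun_deriv_expansion)
  have g: "g u $ l = ?D l 0 u" if "u \<in> {0..\<alpha>}" for u l
    using assms(5)[OF that] by simp

  have "\<exists>!d. d \<in> {..2 * n} \<rightarrow>\<^sub>E (UNIV :: (real ^ 'd) set) \<and>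
          (\<forall>u\<in>{0..\<alpha>}. g u = (\<Sum>i\<le>2 * n. hyp_basis n \<alpha> i u *\<^sub>R d i))"
  proof (rule ex1I[of _ "\<lambda>i\<in>{..2 * n}. \<chi> l. ?ctrl 0 l i"])
    show "(\<lambda>i\<in>{..2 * n}. \<chi> l. ?ctrl 0 l i) \<in> {..2 * n} \<rightarrow>\<^sub>E (UNIV :: (real ^ 'd) set) \<and>
        (\<forall>u\<in>{0..\<alpha>}. g u = (\<Sum>i\<le>2 * n. hyp_basis n \<alpha> i u *\<^sub>R (\<lambda>i\<in>{..2 * n}. \<chi> l. ?ctrl 0 l i) i))"
      using g expansion[of _ _ 0] by (simp add: vec_eq_iff mult.commute)
  next
    fix d :: "nat \<Rightarrow> real ^ 'd"
    assume d: "d \<in> {..2 * n} \<rightarrow>\<^sub>E UNIV \<and>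
             (\<forall>u\<in>{0..\<alpha>}. g u = (\<Sum>i\<le>2 * n. hyp_basis n \<alpha> i u *\<^sub>R d i))"
    have "d i $ l = ?ctrl 0 l i" if "i \<le> 2 * n" for i l
    proof (rule hyp_basis_coeffs_unique[OF \<alpha> _ that, of "\<lambda>i. d i $ l"])
      fix u assume u: "u \<in> {0..\<alpha>}"
      have "(\<Sum>i\<le>2 * n. d i $ l * hyp_basis n \<alpha> i u) = g u $ l"
        using d u by (simp add: mult.commute)
      thus "(\<Sum>i\<le>2 * n. d i $ l * hyp_basis n \<alpha> i u) = (\<Sum>i\<le>2 * n. ?ctrl 0 l i * hyp_basis n \<alpha> i u)"
        using g[OF u] expansion[OF u, of l 0] by simp
    qed
    thus "d = (\<lambda>i\<in>{..2 * n}. \<chi> l. ?ctrl 0 l i)"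
      using d by (intro PiE_ext[of d "{..2 * n}" "\<lambda>_. UNIV"]) (auto simp: vec_eq_iff)
  qed
  moreover have "nth_deriv_on {0..\<alpha>} r (\<lambda>v. g v $ l) differentiable (at u within {0..\<alpha>}) \<and>
      nth_deriv_on {0..\<alpha>} r (\<lambda>v. g v $ l) u = (\<Sum>i\<le>2 * n. ?ctrl r l i * hyp_basis n \<alpha> i u)"
    if "u \<in> {0..\<alpha>}" for r l u
    using nth_deriv_on_interval[of 0 \<alpha> "\<lambda>v. g v $ l" "?D l" u r, OF \<alpha> g
        hyp_fun_deriv_has_vector_derivative that] expansion[OF that, of l r]
    by (auto intro: differentiableI_vector)
  ultimately show ?thesis
    by blast
qed

end
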